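(* Let $m$ be a positive integer and let $h\in\mathcal{C}(I^m)$ be such that $h(x_0)=x_0$ for some $x_0\in\partial I^m$. Then for each $\epsilon>0$ the ball $B_\epsilon(h)$ of radius $\epsilon$ around $h$ contains a map $f$ having a continuous iterative square root on $I^m$, i.e. $f=g\circ g$ for some $g\in\mathcal{C}(I^m)$. In other words, the closure of $\mathcal{W}(2;I^m)$ in $\mathcal{C}(I^m)$ contains all maps in $\mathcal{C}(I^m)$ that have a fixed point on the boundary of $I^m$.
   Context: $I=[0,1]$ and $I^m=\{(x_1,\dots,x_m)\in\mathbb{R}^m: x_i\in I \text{ for } 1\le i\le m\}$, with the metric induced by the norm $\|(x_1,\dots,x_m)\|_\infty=\max\{|x_i|:1\le i\le m\}$; $\partial I^m$ is the boundary of $I^m$ in $\mathbb{R}^m$. $\mathcal{C}(I^m)$ is the space of all continuous self-maps of $I^m$ with the supremum metric $\rho(f,g)=\sup\{\|f(x)-g(x)\|_\infty: x\in I^m\}$, and $B_\epsilon(h)=\{f\in\mathcal{C}(I^m):\rho(f,h)<\epsilon\}$. $\mathcal{W}(2;I^m)=\{g\circ g: g\in\mathcal{C}(I^m)\}$. *)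

theory Defs
  imports "HOL-Analysis.Analysis"
begin

definition icube :: "(real ^ 'm) set" where
  "icube = {x. \<forall>i. x $ i \<in> {0..1}}"

lemma Metric_space_icube:
  "Metric_space (icube :: (real ^ 'm) set) (\<lambda>x y. infnorm (x - y))"
proof
  fix x y z :: "real ^ 'm"
  show "0 \<le> infnorm (x - y)"
    by (rule infnorm_pos_le)
  show "infnorm (x - y) = infnorm (y - x)"
    by (rule infnorm_sub)
  show "infnorm (x - y) = 0 \<longleftrightarrow> x = y"
    by (simp add: infnorm_eq_0)
  show "infnorm (x - z) \<le> infnorm (x - y) + infnorm (y - z)"
    using infnorm_triangle[of "x - y" "y - z"] by simp
qed

definition icube_metric :: "(real ^ 'm) metric" where
  "icube_metric = metric (icube, \<lambda>x y. infnorm (x - y))"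

text \<open>
  The space of continuous self-maps of the cube with the supremum metric.  Its points are
  functions on the whole of \<open>real ^ 'm\<close> that are \<open>undefined\<close> outside \<^term>\<open>icube\<close>, so that
  two maps are equal iff they agree on the cube.  For the same reason composition of self-maps is
  \<^term>\<open>compose icube\<close>, i.e. ordinary composition restricted to the cube.
\<close>

definition self_maps :: "(real ^ 'm \<Rightarrow> real ^ 'm) metric" where
  "self_maps = cfunspace (mtopology_of icube_metric) icube_metric"

definition W2 :: "(real ^ 'm \<Rightarrow> real ^ 'm) set" where
  "W2 = {compose icube g g | g. g \<in> mspace self_maps}"

text \<open>The following lemmas unfold the abstract library notions used above.\<close>

lemma mspace_icube_metric [simp]: "mspace icube_metric = icube"
  by (simp add: icube_metric_def Metric_space.mspace_metric[OF Metric_space_icube])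

lemma mdist_icube_metric [simp]: "mdist icube_metric x y = infnorm (x - y)"
  by (simp add: icube_metric_def Metric_space.mdist_metric[OF Metric_space_icube])

lemma infnorm_vec: "infnorm (x :: real ^ 'm) = Max (range (\<lambda>i. \<bar>x $ i\<bar>))"
proof -
  have "{\<bar>x \<bullet> b\<bar> |b. b \<in> Basis} = range (\<lambda>i. \<bar>x $ i\<bar>)"
    by (force simp: Basis_vec_def inner_axis)
  then show ?thesis
    by (simp add: infnorm_def cSup_eq_Max)
qed

lemma mtopology_of_icube_metric:
  "mtopology_of icube_metric = top_of_set (icube :: (real ^ 'm) set)"
proof -
  interpret I: Metric_space "icube :: (real ^ 'm) set" "\<lambda>x y. infnorm (x - y)"
    by (rule Metric_space_icube)
  define c where "c = sqrt DIM(real ^ 'm)"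
  have c: "c > 0"
    by (simp add: c_def)
  have upper: "dist x y \<le> c * infnorm (x - y)" for x y :: "real ^ 'm"
    using norm_le_infnorm[of "x - y"] by (simp add: c_def dist_norm)
  have lower: "infnorm (x - y) \<le> dist x y" for x y :: "real ^ 'm"
    by (simp add: dist_norm infnorm_le_norm)
  have "openin I.mtopology U \<longleftrightarrow> openin (top_of_set icube) U" for U
  proof
    assume U: "openin I.mtopology U"
    show "openin (top_of_set icube) U"
      unfolding openin_euclidean_subtopology_iff
    proof (intro conjI ballI)
      show "U \<subseteq> icube"
        using U by (simp add: I.openin_mtopology)
      fix x assume "x \<in> U"
      then obtain r where "r > 0" "I.mball x r \<subseteq> U"
        using U I.openin_mtopology by metis
      moreover have "x \<in> icube"
        using \<open>x \<in> U\<close> \<open>U \<subseteq> icube\<close> by auto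
      ultimately show "\<exists>e>0. \<forall>x'\<in>icube. dist x' x < e \<longrightarrow> x' \<in> U"
        using le_less_trans[OF lower]
        by (intro exI[of _ r]) (fastforce simp: I.in_mball subset_iff dist_commute)
    qed
  next
    assume U: "openin (top_of_set icube) U"
    show "openin I.mtopology U"
      unfolding I.openin_mtopology
    proof (intro conjI allI impI)
      show sub: "U \<subseteq> icube"
        using U by (simp add: openin_euclidean_subtopology_iff)
      fix x assume "x \<in> U"
      then obtain e where e: "e > 0" "\<And>x'. x' \<in> icube \<Longrightarrow> dist x' x < e \<Longrightarrow> x' \<in> U"
        using U unfolding openin_euclidean_subtopology_iff by blast
      have "I.mball x (e / c) \<subseteq> U"
      proof
        fix y assume "y \<in> I.mball x (e / c)"
        then have "y \<in> icube" "infnorm (x - y) < e / c"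
          by (auto simp: I.in_mball)
        then have "c * infnorm (x - y) < e"
          using c by (simp add: field_simps)
        then have "dist y x < e"
          using upper[of x y] by (simp add: dist_commute)
        then show "y \<in> U"
          using e \<open>y \<in> icube\<close> by blast
      qed
      then show "\<exists>r>0. I.mball x r \<subseteq> U"
        using e c by (intro exI[of _ "e / c"]) auto
    qed
  qed
  then show ?thesis
    by (simp add: icube_metric_def topology_eq)
qed

lemma compact_icube: "compact (icube :: (real ^ 'm) set)"
proof -
  have "icube = cbox (0 :: real ^ 'm) 1"
    by (auto simp: icube_def mem_box_cart)
  then show ?thesis
    by (metis compact_cbox)
qed

lemma mspace_self_maps:
  "f \<in> mspace self_maps \<longleftrightarrow> f \<in> extensional icube \<and> continuous_on icube f \<and> f ` icube \<subseteq> icube"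
proof -
  have "compactin (top_of_set icube) (topspace (top_of_set (icube :: (real ^ 'm) set)))"
    using compact_icube by (simp add: compactin_subtopology)
  then have "mspace (self_maps :: (real ^ 'm \<Rightarrow> real ^ 'm) metric) =
      {f. (\<forall>x\<in>icube. f x \<in> icube) \<and> f \<in> extensional icube \<and>
          continuous_map (top_of_set icube) (mtopology_of icube_metric) f}"
    unfolding self_maps_def mtopology_of_icube_metric
    by (subst compactin_mspace_cfunspace) (auto simp: mtopology_of_icube_metric)
  then show ?thesis
    by (auto simp: mtopology_of_icube_metric)
qed

lemma mdist_self_maps:
  fixes f g :: "real ^ 'm \<Rightarrow> real ^ 'm"
  assumes "f \<in> mspace self_maps" "g \<in> mspace self_maps"
  shows "mdist self_maps f g = (SUP x\<in>icube. infnorm (f x - g x))"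
proof -
  have "(0 :: real ^ 'm) \<in> icube"
    by (simp add: icube_def)
  then have ne: "(icube :: (real ^ 'm) set) \<noteq> {}"
    by blast
  interpret I: Metric_space "icube :: (real ^ 'm) set" "mdist icube_metric"
    using Metric_space_mspace_mdist[of icube_metric] by simp
  show ?thesis
    using assms ne unfolding self_maps_def
    by (simp add: mdist_cfunspace_eq_mdist_funspace I.fdist_def I.fspace_def Pi_iff image_subset_iff)
qed

end

theory Submission
  imports Defs
begin

text \<open>
  Let \<open>x0\<close> lie on a face \<open>x $ i = 0\<close> or \<open>x $ i = 1\<close>, and let \<open>a\<close> be \<open>x0\<close> pushed slightly inwards.  Up to a
  small error \<open>h\<close> may be replaced by a map \<open>f\<close> that is constantly \<open>a\<close> on a neighbourhood \<open>U\<close> of \<open>x0\<close> and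
  takes no value in a smaller neighbourhood \<open>V\<close>.  Let \<open>s\<close> embed the cube into \<open>V\<close>.  Put \<open>g = s\<close> off \<open>U\<close>
  and let \<open>g\<close> extend \<open>f \<circ> s\<^sup>-\<^sup>1\<close> on \<open>V\<close>; then \<open>g \<circ> g = f\<close> off \<open>U\<close>.  On \<open>U - V\<close> interpolate linearly between \<open>a\<close>
  and \<open>s\<close>.  For \<open>g \<circ> g\<close> to stay near \<open>x0\<close> there, the interpolating segments must avoid the points
  of \<open>V\<close> that \<open>g\<close> moves far away; this is possible because \<open>x0\<close> is on the boundary: \<open>s\<close> can reverse
  the direction normal to the face.
\<close>

section \<open>Convexity in the infinity norm, faces of the cube, and a cutoff function\<close>

lemma infnorm_le_iff_vec: "infnorm (x :: real ^ 'm) \<le> b \<longleftrightarrow> (\<forall>i. \<bar>x $ i\<bar> \<le> b)"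
  by (simp add: infnorm_vec)

text \<open>Ensures that interpolating between two maps that are both close to a given point loses
  nothing in the estimate.\<close>

lemma convex_infnorm_ball: "convex {x. infnorm (x - y) \<le> b}" for y :: "real ^ 'm"
proof (rule convexI)
  fix p q :: "real ^ 'm" and u v :: real
  assume "p \<in> {x. infnorm (x - y) \<le> b}" "q \<in> {x. infnorm (x - y) \<le> b}"
    and uv: "0 \<le> u" "0 \<le> v" "u + v = 1"
  then have pq: "infnorm (p - y) \<le> b" "infnorm (q - y) \<le> b"
    by auto
  have "u *\<^sub>R p + v *\<^sub>R q - y = u *\<^sub>R (p - y) + v *\<^sub>R (q - y)"
    using uv by (simp add: algebra_simps flip: scaleR_add_left)
  then have "infnorm (u *\<^sub>R p + v *\<^sub>R q - y) \<le> u * infnorm (p - y) + v * infnorm (q - y)"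
    using infnorm_triangle[of "u *\<^sub>R (p - y)" "v *\<^sub>R (q - y)"] uv by (simp add: infnorm_mul)
  also have "\<dots> \<le> b"
    using pq uv by (rule convex_bound_le)
  finally show "u *\<^sub>R p + v *\<^sub>R q \<in> {x. infnorm (x - y) \<le> b}"
    by simp
qed

lemma icube_eq_cbox: "icube = cbox (0 :: real ^ 'm) 1"
  by (auto simp: icube_def mem_box_cart)

lemma frontier_icubeE:
  assumes "x \<in> frontier (icube :: (real ^ 'm) set)"
  obtains i where "x \<in> icube" "x $ i = 0 \<or> x $ i = 1"
proof -
  have "x \<in> icube" "\<not> (\<forall>i. 0 < x $ i \<and> x $ i < 1)"
    using assms by (auto simp: icube_eq_cbox frontier_cbox mem_box_cart)
  then obtain i where "x \<in> icube" "x $ i \<le> 0 \<or> 1 \<le> x $ i"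
    by (auto simp: not_less)
  then show ?thesis
    using that[of i] by (auto simp: icube_def intro: antisym)
qed

definition ramp :: "real \<Rightarrow> real \<Rightarrow> real \<Rightarrow> real" where
  "ramp p q t = max 0 (min 1 ((t - p) / (q - p)))"

lemma ramp_bounds: "0 \<le> ramp p q t" "ramp p q t \<le> 1"
  by (auto simp: ramp_def)

lemma ramp_eq_0: "p < q \<Longrightarrow> t \<le> p \<Longrightarrow> ramp p q t = 0"
  by (simp add: ramp_def max_def min_def divide_simps)

lemma ramp_eq_1: "p < q \<Longrightarrow> q \<le> t \<Longrightarrow> ramp p q t = 1"
  by (simp add: ramp_def max_def min_def divide_simps)

lemma continuous_on_ramp [continuous_intros]:
  assumes "continuous_on S f"
  shows "continuous_on S (\<lambda>x. ramp p q (f x))"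
  unfolding ramp_def divide_inverse by (intro continuous_intros assms)

text \<open>The factor 3/4 is slack: a pointwise bound strictly below \<open>\<epsilon>\<close> by a
  fixed amount survives passing to the supremum.\<close>

lemma approx_iterative_square_root:
  fixes h :: "real ^ 'm \<Rightarrow> real ^ 'm"
  assumes conth: "continuous_on icube h" and himg: "h ` icube \<subseteq> icube"
    and x0: "x0 \<in> icube" "x0 $ i = 0 \<or> x0 $ i = 1" and fixp: "h x0 = x0" and "\<epsilon> > 0"
  obtains g where "continuous_on icube g" "g ` icube \<subseteq> icube"
    "\<And>x. x \<in> icube \<Longrightarrow> infnorm (g (g x) - h x) \<le> 3 / 4 * \<epsilon>"
proof -
  let ?K = "icube :: (real ^ 'm) set"
  have convK: "convex ?K"
    by (simp add: icube_eq_cbox)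
  have inK: "x $ j \<ge> 0" "x $ j \<le> 1" if "x \<in> ?K" for x j
    using that by (auto simp: icube_def)
  \<comment> \<open>The estimate is needed up to \<open>2 * r\<close>, since \<open>f\<close> will
    be constant up to distance \<open>r\<close> and return to (almost) \<open>h\<close> between
    \<open>r\<close> and \<open>2 * r\<close>.\<close>
  obtain r where r: "r > 0" and hnear: "\<And>x. x \<in> ?K \<Longrightarrow> infnorm (x - x0) < 2 * r \<Longrightarrow> infnorm (h x - x0) \<le> \<epsilon> / 4"
  proof -
    obtain \<delta> where "\<delta> > 0" and \<delta>: "\<And>x. x \<in> ?K \<Longrightarrow> dist x x0 < \<delta> \<Longrightarrow> dist (h x) (h x0) < \<epsilon> / 4"
      using conth x0 \<open>\<epsilon> > 0\<close> unfolding continuous_on_iff by (metis divide_pos_pos zero_less_numeral)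
    define k where "k = sqrt DIM(real ^ 'm)"
    have k: "k > 0"
      by (simp add: k_def)
    show ?thesis
    proof
      show "\<delta> / (2 * k) > 0"
        using \<open>\<delta> > 0\<close> k by simp
      fix x assume x: "x \<in> ?K" "infnorm (x - x0) < 2 * (\<delta> / (2 * k))"
      then have "k * infnorm (x - x0) < \<delta>"
        using k by (simp add: field_simps)
      then have "dist x x0 < \<delta>"
        using norm_le_infnorm[of "x - x0"] by (simp add: k_def dist_norm)
      then have "norm (h x - x0) < \<epsilon> / 4"
        using \<delta>[OF x(1)] fixp by (simp add: dist_norm)
      then show "infnorm (h x - x0) \<le> \<epsilon> / 4"
        using infnorm_le_norm[of "h x - x0"] by simp
    qed
  qed
  \<comment> \<open>\<open>\<alpha> \<le> 1\<close> keeps \<open>a\<close> in the cube, and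
    \<open>\<alpha> \<le> \<epsilon> / 4\<close> bounds each displacement. The order
    \<open>c < v < \<alpha>\<close> puts the image of \<open>s\<close> inside the ball of radius
    \<open>v\<close> and the values of \<open>f\<close> outside it.\<close>
  define \<alpha> where "\<alpha> = min r (min 1 (\<epsilon> / 4))"
  have \<alpha>: "0 < \<alpha>" "\<alpha> \<le> r" "\<alpha> \<le> 1" "\<alpha> \<le> \<epsilon> / 4"
    using r \<open>\<epsilon> > 0\<close> by (auto simp: \<alpha>_def)
  define v where "v = \<alpha> / 2"
  define c where "c = \<alpha> / 4"
  have v: "0 < v" "v < \<alpha>" "v < r" and c: "0 < c" "c < v" "c \<le> 1"
    using \<alpha> by (auto simp: v_def c_def)
  \<comment> \<open>\<open>\<sigma>\<close> is the sign of the inward normal, so on the cube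
    \<open>t\<close> is the depth below the face through \<open>x0\<close>. This treats both kinds
    of face at once.\<close>
  define \<sigma> where "\<sigma> = 1 - 2 * x0 $ i"
  define t where "t = (\<lambda>x :: real ^ 'm. \<sigma> * (x $ i - x0 $ i))"
  have \<sigma>: "\<sigma> = 1 \<and> x0 $ i = 0 \<or> \<sigma> = -1 \<and> x0 $ i = 1"
    using x0 by (auto simp: \<sigma>_def)
  have t_bounds: "0 \<le> t x" "t x \<le> 1" if "x \<in> ?K" for x
    using \<sigma> inK[OF that, of i] by (auto simp: t_def)
  have abs_t: "\<bar>x $ i - x0 $ i\<bar> = t x" if "x \<in> ?K" for x
    using \<sigma> inK[OF that, of i] by (auto simp: t_def)
  have cont_t: "continuous_on S t" for S
    unfolding t_def by (intro continuous_intros)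
  have cont_n: "continuous_on S (\<lambda>x. infnorm (x - x0))" for S
    by (intro continuous_on_compose2[OF continuous_on_infnorm[OF continuous_on_id]] continuous_intros) auto
  define a where "a = x0 + \<alpha> *\<^sub>R axis i \<sigma>"
  have a_nth: "a $ j = (if j = i then x0 $ i + \<alpha> * \<sigma> else x0 $ j)" for j
    by (simp add: a_def axis_def)
  have aK: "a \<in> ?K"
    using \<sigma> \<alpha> inK[OF x0(1)] by (auto simp: icube_def a_nth)
  have ta: "t a = \<alpha>"
    using \<sigma> by (auto simp: t_def a_nth)
  have an: "infnorm (a - x0) \<le> \<alpha>"
    using \<sigma> \<alpha> by (auto simp: infnorm_le_iff_vec a_nth)

  \<comment> \<open>The flip of coordinate \<open>i\<close> turns \<open>x0\<close> into the point of \<open>s ` ?K\<close> lying deepest in the cube, so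
    that \<open>s\<close> of a neighbourhood of \<open>x0\<close> can be joined to \<open>a\<close> without crossing the rest of \<open>s ` ?K\<close>.\<close>
  define s where "s = (\<lambda>x. x0 + c *\<^sub>R (x + axis i (1 - 2 * x $ i) - x0))"
  have s_nth: "s x $ j = (if j = i then x0 $ i + c * (1 - x $ i - x0 $ i) else x0 $ j + c * (x $ j - x0 $ j))" for x j
    by (simp add: s_def axis_def)
  have ts: "t (s x) = c * (1 - t x)" for x
    using \<sigma> by (auto simp: t_def s_nth algebra_simps)
  have sK: "s x \<in> ?K" if "x \<in> ?K" for x
  proof -
    have "x + axis i (1 - 2 * x $ i) \<in> ?K"
      using inK[OF that] by (auto simp: icube_def axis_def)
    then have "(1 - c) *\<^sub>R x0 + c *\<^sub>R (x + axis i (1 - 2 * x $ i)) \<in> ?K"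
      using convexD[OF convK x0(1), of _ "1 - c" c] c by simp
    then show ?thesis
      by (simp add: s_def algebra_simps)
  qed
  have sn: "infnorm (s x - x0) \<le> c" if "x \<in> ?K" for x
  proof -
    have "\<bar>1 - x $ i - x0 $ i\<bar> \<le> 1" "\<And>j. \<bar>x $ j - x0 $ j\<bar> \<le> 1"
      using inK[OF that] inK[OF x0(1)] by (auto simp: abs_le_iff) (smt (verit))+
    then show ?thesis
      using c by (auto simp: infnorm_le_iff_vec s_nth abs_mult mult_left_le)
  qed
  have conts: "continuous_on S s" for S
  proof -
    have "s = (\<lambda>x. x0 + c *\<^sub>R (x + (1 - 2 * x $ i) *\<^sub>R axis i 1 - x0))"
      by (auto simp: fun_eq_iff s_def vec_eq_iff axis_def)
    then show ?thesis
      by (simp only:) (intro continuous_intros)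
  qed
  have injs: "inj s"
  proof (rule injI)
    fix x y assume "s x = s y"
    then have *: "s x $ j = s y $ j" for j
      by simp
    have "x $ j = y $ j" for j
    proof (cases "j = i")
      case True
      then show ?thesis
        using *[of i] c by (simp add: s_nth)
    next
      case False
      then show ?thesis
        using *[of j] c by (simp add: s_nth)
    qed
    then show "x = y"
      by (simp add: vec_eq_iff)
  qed

  \<comment> \<open>The modified map \<open>f\<close> and its convex target
    \<open>Kd\<close>\<close>
  have conv_t: "convex {x. b \<le> t x}" for b
  proof -
    have "{x. b \<le> t x} = {x. (\<sigma> *\<^sub>R axis i 1) \<bullet> x \<ge> b + \<sigma> * x0 $ i}"
      by (auto simp: t_def inner_axis' algebra_simps)
    then show ?thesis
      by (simp only: convex_halfspace_ge)
  qed
  define Kd where "Kd = {x \<in> ?K. \<alpha> \<le> t x}"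
  have convKd: "convex Kd"
    using convex_Int[OF convK conv_t[of \<alpha>]] by (simp add: Kd_def Collect_conj_eq)
  have aKd: "a \<in> Kd"
    using aK ta by (simp add: Kd_def)
  have Kd_far: "v \<le> infnorm (x - x0)" if "x \<in> Kd" for x
  proof -
    have "\<alpha> \<le> \<bar>(x - x0) $ i\<bar>"
      using that abs_t by (simp add: Kd_def)
    also have "\<dots> \<le> infnorm (x - x0)"
      using infnorm_le_iff_vec by blast
    finally show ?thesis
      using v by simp
  qed
  \<comment> \<open>A retraction of the cube onto \<open>Kd\<close>, moving points only along the
    normal; it clears the values of \<open>h\<close> away from \<open>x0\<close>.\<close>
  define push where "push = (\<lambda>x. x + max 0 (\<alpha> - t x) *\<^sub>R axis i \<sigma>)"
  have push_nth: "push x $ j = (if j = i then x $ i + max 0 (\<alpha> - t x) * \<sigma> else x $ j)" for x j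
    by (simp add: push_def axis_def)
  have pushKd: "push x \<in> Kd" if "x \<in> ?K" for x
  proof -
    have "t (push x) = max \<alpha> (t x)"
      using \<sigma> by (auto simp: t_def push_nth max_def)
    moreover have "push x \<in> ?K"
      using \<sigma> inK[OF that] \<alpha> by (auto simp: icube_def push_nth t_def max_def)
    ultimately show ?thesis
      by (simp add: Kd_def)
  qed
  have push_near: "infnorm (push x - x) \<le> \<alpha>" if "x \<in> ?K" for x
    using \<sigma> \<alpha> t_bounds[OF that] by (auto simp: infnorm_le_iff_vec push_nth)
  have cont_push: "continuous_on S push" for S
    unfolding push_def by (intro continuous_intros cont_t)

  define \<eta> where "\<eta> = (\<lambda>x. ramp r (2 * r) (infnorm (x - x0)))"
  define f where "f = (\<lambda>x. (1 - \<eta> x) *\<^sub>R a + \<eta> x *\<^sub>R push (h x))"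
  have contf: "continuous_on ?K f"
    unfolding f_def \<eta>_def
    by (intro continuous_intros cont_n continuous_on_compose2[OF cont_push[of UNIV] conth]) auto
  have fKd: "f x \<in> Kd" if "x \<in> ?K" for x
    using convexD[OF convKd aKd pushKd, of "h x" "1 - \<eta> x" "\<eta> x"] himg that
    by (auto simp: f_def \<eta>_def ramp_bounds)
  have fa: "f x = a" if "infnorm (x - x0) \<le> r" for x
    using that r by (simp add: f_def \<eta>_def ramp_eq_0)
  have fh: "infnorm (f x - h x) \<le> \<epsilon> / 2" if "x \<in> ?K" for x
  proof (cases "infnorm (x - x0) < 2 * r")
    case True
    have hx: "h x \<in> ?K"
      using that himg by auto
    have "infnorm (a - h x) \<le> \<epsilon> / 2"
      using infnorm_triangle[of "a - x0" "x0 - h x"] infnorm_sub[of x0 "h x"] hnear[OF that True] an \<alpha> by simp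
    moreover have "infnorm (push (h x) - h x) \<le> \<epsilon> / 2"
      using push_near[OF hx] \<alpha> by simp
    ultimately show ?thesis
      using convexD[OF convex_infnorm_ball[of "h x" "\<epsilon> / 2"], of a "push (h x)" "1 - \<eta> x" "\<eta> x"]
      by (auto simp: f_def \<eta>_def ramp_bounds)
  next
    case False
    then have "f x = push (h x)"
      using r by (simp add: f_def \<eta>_def ramp_eq_1)
    then show ?thesis
      using push_near[of "h x"] himg that \<alpha> by force
  qed

  \<comment> \<open>\<open>C\<close> contains all segments from \<open>a\<close> to \<open>s x\<close> with \<open>x\<close> near \<open>x0\<close>, but meets \<open>s ` ?K\<close> only where
    \<open>f \<circ> s\<^sup>-\<^sup>1\<close> equals \<open>a\<close>; this makes the prescription \<open>\<phi>0\<close> below consistent.\<close>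
  define C where "C = {z \<in> ?K. c * (1 - r) \<le> t z \<and> (\<forall>j. j \<noteq> i \<longrightarrow> \<bar>z $ j - x0 $ j\<bar> \<le> c * r)}"
  \<comment> \<open>On \<open>T\<close> the extension \<open>\<phi>\<close> will be
    \<open>a\<close>, so that there \<open>g\<close> interpolates between \<open>a\<close> and
    \<open>s\<close>.\<close>
  define T where "T = {z \<in> ?K. v \<le> infnorm (z - x0)} \<union> C"
  have clT: "closed T"
  proof -
    have K: "closed ?K"
      by (rule compact_imp_closed[OF compact_icube])
    have "closed {z. v \<le> infnorm (z - x0)}"
      by (intro closed_Collect_le continuous_intros cont_n)
    moreover have "closed {z. c * (1 - r) \<le> t z}"
      by (intro closed_Collect_le continuous_intros cont_t)
    moreover have "closed {z :: real ^ 'm. \<forall>j. j \<noteq> i \<longrightarrow> \<bar>z $ j - x0 $ j\<bar> \<le> c * r}"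
      by (intro closed_Collect_all closed_Collect_imp closed_Collect_le continuous_intros) auto
    ultimately have "closed (?K \<inter> {z. v \<le> infnorm (z - x0)} \<union> ?K \<inter> ({z. c * (1 - r) \<le> t z} \<inter> 
        {z :: real ^ 'm. \<forall>j. j \<noteq> i \<longrightarrow> \<bar>z $ j - x0 $ j\<bar> \<le> c * r}))"
      using K by (intro closed_Un closed_Int)
    also have "\<dots> = T"
      by (auto simp: T_def C_def)
    finally show ?thesis .
  qed
  \<comment> \<open>The flip is decisive here: by \<open>ts\<close>, a lower bound on the depth of
    \<open>s y\<close> is an upper bound on the depth of \<open>y\<close>.\<close>
  have s_CD: "infnorm (y - x0) \<le> r" if "y \<in> ?K" "s y \<in> C" for y
  proof -
    have "\<bar>(y - x0) $ j\<bar> \<le> r" for j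
    proof (cases "j = i")
      case True
      have "c * (1 - r) \<le> c * (1 - t y)"
        using that by (simp add: C_def ts)
      then show ?thesis
        using True c abs_t[OF that(1)] by simp
    next
      case False
      then have "\<bar>s y $ j - x0 $ j\<bar> \<le> c * r"
        using that unfolding C_def by blast
      then show ?thesis
        using False c by (simp add: s_nth abs_mult)
    qed
    then show ?thesis
      by (simp add: infnorm_le_iff_vec)
  qed
  have s_T: "f y = a" if "y \<in> ?K" "s y \<in> T" for y
    using that s_CD[of y] sn[of y] c fa by (auto simp: T_def)

  \<comment> \<open>Continuous extension of \<open>\<phi>0\<close> to the cube\<close>
  define \<phi>0 where "\<phi>0 = (\<lambda>z. if z \<in> T then a else f (inv_into ?K s z))"
  have inv_s: "inv_into ?K s (s y) = y" if "y \<in> ?K" for y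
    using injs that by (meson inj_on_subset inv_into_f_f subset_UNIV)
  have cont_inv: "continuous_on (s ` ?K) (\<lambda>z. f (inv_into ?K s z))"
  proof (rule continuous_on_compose2[OF contf])
    show "continuous_on (s ` ?K) (inv_into ?K s)"
      by (rule continuous_on_inv[OF conts compact_icube]) (simp add: inv_s)
  qed (auto simp: inv_s)
  have cont\<phi>0: "continuous_on (T \<union> s ` ?K) \<phi>0"
    unfolding \<phi>0_def
  proof (rule continuous_on_cases[OF clT _ _ cont_inv])
    show "closed (s ` ?K)"
      by (intro compact_imp_closed compact_continuous_image conts compact_icube)
  qed (auto simp: inv_s s_T)
  have cl: "closedin (top_of_set ?K) (T \<union> s ` ?K)"
  proof (rule closed_subset)
    show "T \<union> s ` ?K \<subseteq> ?K"
      using sK by (auto simp: T_def C_def)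
    show "closed (T \<union> s ` ?K)"
      by (intro closed_Un clT compact_imp_closed compact_continuous_image conts compact_icube)
  qed
  have maps\<phi>0: "\<phi>0 ` (T \<union> s ` ?K) \<subseteq> Kd"
    using aKd fKd by (auto simp: \<phi>0_def inv_s)
  have "Kd \<noteq> {}"
    using aKd by blast
  \<comment> \<open>Extending into the convex set \<open>Kd\<close> rather than the whole cube makes
    \<open>\<phi>\<close> avoid the ball of radius \<open>v\<close>.\<close>
  from Dugundji[OF convKd this cl cont\<phi>0 maps\<phi>0] obtain \<phi> where cont\<phi>: "continuous_on ?K \<phi>" and \<phi>Kd: "\<phi> ` ?K \<subseteq> Kd"
    and \<phi>: "\<And>z. z \<in> T \<union> s ` ?K \<Longrightarrow> \<phi> z = \<phi>0 z"
    by metis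
  have \<phi>T: "\<phi> z = a" if "z \<in> T" for z
    using \<phi>[of z] that by (simp add: \<phi>0_def)
  have \<phi>s: "\<phi> (s y) = f y" if "y \<in> ?K" for y
    using \<phi>[of "s y"] that by (simp add: \<phi>0_def inv_s s_T)

  \<comment> \<open>The square root \<open>g\<close>\<close>
  define \<theta> where "\<theta> = (\<lambda>x. ramp v r (infnorm (x - x0)))"
  \<comment> \<open>One formula covers all regions: wherever \<open>\<theta>\<close> is nonzero,
    \<open>\<phi>\<close> is \<open>a\<close>, so the sum is a convex combination of
    \<open>a\<close> and \<open>s x\<close>.\<close>
  define g where "g = (\<lambda>x. \<phi> x + \<theta> x *\<^sub>R (s x - a))"
  have contg: "continuous_on ?K g"
    unfolding g_def \<theta>_def by (intro continuous_intros cont\<phi> conts cont_n)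
  have g_core: "g x = \<phi> x" if "infnorm (x - x0) \<le> v" for x
    using that v by (simp add: g_def \<theta>_def ramp_eq_0)
  \<comment> \<open>The convex set is left open because a ball around \<open>x0\<close>, the cube
    and \<open>C\<close> all take its place below.\<close>
  have g_T: "g x \<in> S" if "x \<in> T" "convex S" "a \<in> S" "s x \<in> S" for x S
  proof -
    have "g x = (1 - \<theta> x) *\<^sub>R a + \<theta> x *\<^sub>R s x"
      using \<phi>T[OF that(1)] by (simp add: g_def algebra_simps)
    then show ?thesis
      using convexD[OF that(2-4), of "1 - \<theta> x" "\<theta> x"] by (simp add: \<theta>_def ramp_bounds)
  qed
  have TK: "x \<in> ?K" if "x \<in> T" for x
    using that by (auto simp: T_def C_def)
  have g_T_near: "infnorm (g x - x0) \<le> \<alpha>" if "x \<in> T" for x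
    using g_T[OF that convex_infnorm_ball[of x0 \<alpha>]] an sn[OF TK[OF that]] c v by auto
  have gK: "g x \<in> ?K" if "x \<in> ?K" for x
  proof (cases "infnorm (x - x0) \<le> v")
    case True
    then show ?thesis
      using g_core \<phi>Kd that by (force simp: Kd_def)
  next
    case False
    then have "x \<in> T"
      using that by (simp add: T_def)
    then show ?thesis
      using g_T convK aK sK that by blast
  qed
  have convC: "convex C"
  proof (rule convexI)
    fix x y and p q :: real
    assume *: "x \<in> C" "y \<in> C" "0 \<le> p" "0 \<le> q" "p + q = 1"
    have "p *\<^sub>R x + q *\<^sub>R y \<in> ?K"
      using * convexD[OF convK] by (simp add: C_def)
    moreover have "c * (1 - r) \<le> t (p *\<^sub>R x + q *\<^sub>R y)"
      using * convexD[OF conv_t[of "c * (1 - r)"]] by (simp add: C_def)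
    moreover have "\<bar>(p *\<^sub>R x + q *\<^sub>R y) $ j - x0 $ j\<bar> \<le> c * r" if "j \<noteq> i" for j
    proof -
      have "(p *\<^sub>R x + q *\<^sub>R y) $ j - x0 $ j = p * (x $ j - x0 $ j) + q * (y $ j - x0 $ j) + (p + q - 1) * x0 $ j"
        by (simp add: algebra_simps)
      moreover have "\<bar>p * (x $ j - x0 $ j) + q * (y $ j - x0 $ j)\<bar> \<le> p * \<bar>x $ j - x0 $ j\<bar> + q * \<bar>y $ j - x0 $ j\<bar>"
        using *(3,4) abs_triangle_ineq by (metis abs_mult abs_of_nonneg)
      moreover have "p * \<bar>x $ j - x0 $ j\<bar> + q * \<bar>y $ j - x0 $ j\<bar> \<le> c * r"
        using * that by (intro convex_bound_le) (auto simp: C_def)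
      ultimately show ?thesis
        using *(5) by simp
    qed
    ultimately show "p *\<^sub>R x + q *\<^sub>R y \<in> C"
      by (simp add: C_def)
  qed
  have aC: "a \<in> C"
  proof -
    have "c * (1 - r) \<le> \<alpha>"
      unfolding right_diff_distrib using mult_pos_pos[OF c(1) r] c v by linarith
    then show ?thesis
      using aK ta c v r by (simp add: C_def a_nth)
  qed
  have sC: "s x \<in> C" if "x \<in> ?K" "infnorm (x - x0) \<le> r" for x
  proof -
    have *: "\<bar>x $ j - x0 $ j\<bar> \<le> r" for j
      using that(2) by (simp add: infnorm_le_iff_vec)
    then show ?thesis
      using *[of i] c sK[OF that(1)] abs_t[OF that(1)] by (simp add: C_def ts s_nth abs_mult)
  qed

  \<comment> \<open>Comparison of the second iterate of \<open>g\<close> with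
    \<open>h\<close>\<close>
  have "infnorm (g (g x) - h x) \<le> 3 / 4 * \<epsilon>" if x: "x \<in> ?K" for x
  proof (cases "infnorm (x - x0) \<le> r")
    case True
    \<comment> \<open>Near \<open>x0\<close> the first step lands in \<open>Kd\<close> or in
      \<open>C\<close>, both inside \<open>T\<close>, from which the second step returns close to
      \<open>x0\<close>.\<close>
    have "g x \<in> T"
    proof (cases "infnorm (x - x0) \<le> v")
      case True
      then have "g x \<in> Kd"
        using g_core \<phi>Kd x by force
      then show ?thesis
        using Kd_far by (simp add: T_def Kd_def)
    next
      case False
      then have "x \<in> T"
        using x by (simp add: T_def)
      then have "g x \<in> C"
        using g_T convC aC sC[OF x True] by blast
      then show ?thesis
        by (simp add: T_def)
    qed
    then have "infnorm (g (g x) - x0) \<le> \<alpha>"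
      by (rule g_T_near)
    moreover have "infnorm (h x - x0) \<le> \<epsilon> / 4"
      using True r by (intro hnear[OF x]) auto
    ultimately show ?thesis
      using infnorm_triangle[of "g (g x) - x0" "x0 - h x"] infnorm_sub[of x0 "h x"] \<alpha> by simp
  next
    case False
    then have "x \<in> T"
      using x v by (simp add: T_def)
    then have "g x = s x"
      using False v by (simp add: g_def \<phi>T \<theta>_def ramp_eq_1)
    \<comment> \<open>\<open>s x\<close> is within \<open>c < v\<close> of \<open>x0\<close>, where
      \<open>g\<close> is \<open>\<phi>\<close> and hence undoes \<open>s\<close> before applying
      \<open>f\<close>.\<close>
    moreover have "g (s x) = f x"
      using g_core[of "s x"] sn[OF x] c \<phi>s[OF x] by simp
    ultimately show ?thesis
      using fh[OF x] \<open>\<epsilon> > 0\<close> by simp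
  qed
  then show ?thesis
    using that contg gK by blast
qed

section \<open>Passage to the space of self-maps\<close>

lemma ball_meets_W2:
  fixes h :: "real ^ 'm \<Rightarrow> real ^ 'm"
  assumes h: "h \<in> mspace self_maps" and "x0 \<in> frontier icube" "h x0 = x0" "\<epsilon> > 0"
  shows "\<exists>f\<in>mball_of self_maps h \<epsilon>. \<exists>g\<in>mspace self_maps. f = compose icube g g"
proof -
  obtain i where i: "x0 \<in> icube" "x0 $ i = 0 \<or> x0 $ i = 1"
    using assms frontier_icubeE by blast
  obtain g0 where g0: "continuous_on icube g0" "g0 ` icube \<subseteq> icube"
    and near: "\<And>x. x \<in> icube \<Longrightarrow> infnorm (g0 (g0 x) - h x) \<le> 3 / 4 * \<epsilon>"
    using approx_iterative_square_root[of h x0 i \<epsilon>] h i assms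
    unfolding mspace_self_maps by blast
  \<comment> \<open>Points of \<open>self_maps\<close> must be \<open>undefined\<close> off the
    cube.\<close>
  define g where "g = restrict g0 icube"
  have g: "g \<in> mspace self_maps"
    using g0 by (auto simp: g_def mspace_self_maps cong: continuous_on_cong)
  define f where "f = compose icube g g"
  have fx: "f x = g0 (g0 x)" if "x \<in> icube" for x
    using that g0(2) by (auto simp: f_def g_def compose_def)
  have "continuous_on icube (\<lambda>x. g0 (g0 x))"
    using g0 by (auto intro: continuous_on_compose2)
  then have f: "f \<in> mspace self_maps"
    using g0(2) fx unfolding mspace_self_maps
    by (auto simp: f_def compose_extensional image_subset_iff cong: continuous_on_cong)
  have "mdist self_maps h f = (SUP x\<in>icube. infnorm (h x - f x))"
    by (rule mdist_self_maps[OF h f])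
  also have "\<dots> \<le> 3 / 4 * \<epsilon>"
    using near fx i by (intro cSUP_least) (auto simp: infnorm_sub[of "h _"])
  also have "\<dots> < \<epsilon>"
    using \<open>\<epsilon> > 0\<close> by simp
  finally have "f \<in> mball_of self_maps h \<epsilon>"
    using h f by simp
  then show ?thesis
    using g f_def by blast
qed

theorem theorem3p9:
  shows "(\<forall>h :: real ^ 'm \<Rightarrow> real ^ 'm.
            h \<in> mspace self_maps \<longrightarrow> (\<exists>x0\<in>frontier icube. h x0 = x0) \<longrightarrow>
              (\<forall>\<epsilon>>0. \<exists>f\<in>mball_of self_maps h \<epsilon>. \<exists>g\<in>mspace self_maps. f = compose icube g g))
       \<and> {h :: real ^ 'm \<Rightarrow> real ^ 'm.
            h \<in> mspace self_maps \<and> (\<exists>x0\<in>frontier icube. h x0 = x0)}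
           \<subseteq> mtopology_of self_maps closure_of W2"
proof (intro conjI subsetI)
  interpret S: Metric_space "mspace self_maps" "mdist (self_maps :: (real ^ 'm \<Rightarrow> real ^ 'm) metric)"
    by (rule Metric_space_mspace_mdist)
  fix h :: "real ^ 'm \<Rightarrow> real ^ 'm"
  assume "h \<in> {h. h \<in> mspace self_maps \<and> (\<exists>x0\<in>frontier icube. h x0 = x0)}"
  then have h: "h \<in> mspace self_maps"
    and "\<And>\<epsilon>. \<epsilon> > 0 \<Longrightarrow> \<exists>f\<in>mball_of self_maps h \<epsilon>. \<exists>g\<in>mspace self_maps. f = compose icube g g"
    using ball_meets_W2 by blast+
  then have "\<exists>f\<in>W2. f \<in> S.mball h \<epsilon>" if "\<epsilon> > 0" for \<epsilon>
    using that unfolding W2_def mball_of_def by blast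
  then show "h \<in> mtopology_of self_maps closure_of W2"
    using h unfolding mtopology_of_def S.metric_closure_of by blast
qed (use ball_meets_W2 in blast)

end
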